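(* For every integer $k\ge1$ and every $s=0,\dots,k$ the identity $$\sum_{s,k}\frac{k!}{1^{\alpha_1}\alpha_1!\cdots k^{\alpha_k}\alpha_k!}=\sum_{m=1}^{k-s}\ \sum_{m,k-s}C_{\alpha_1,\dots,\alpha_{k-s}}^{k-s,m,k}$$ holds.
   Context: For integers $p,q$, $\sum_{p,q}$ denotes summation over all tuples of nonnegative integers $(\alpha_1,\dots,\alpha_q)$ with $\sum_{i=1}^q\alpha_i=p$ and $\sum_{i=1}^q i\alpha_i=q$. For integers $k\ge1$, $1\le s\le k-1$, $1\le m\le s$ and nonnegative integers $\alpha_1,\dots,\alpha_s$ with $\sum_{i=1}^s\alpha_i=m$, $\sum_{i=1}^s i\alpha_i=s$, the numbers $C_{\alpha_1,\dots,\alpha_s}^{s,m,k}$ are the uniquely determined universal numbers (not depending on $u$) such that for every entire or meromorphic function $u$ on $\mathbb{C}$ the operator $A=u(z)\frac{d}{dz}$ satisfies $$A^{k}=u^k\Big(\frac{d}{dz}\Big)^k+\sum_{s=1}^{k-1}\Big(\sum_{m=1}^{s}u^{k-m}\sum_{m,s}C_{\alpha_1,\dots,\alpha_s}^{s,m,k}\Big(\frac{du}{dz}\Big)^{\alpha_1}\cdots\Big(\frac{d^su}{dz^s}\Big)^{\alpha_s}\Big)\Big(\frac{d}{dz}\Big)^{k-s}.$$ Conventions: when $k-s=0$ the double sum on the right-hand side of the claim is understood to equal $1$ (coefficient of $u^k(d/dz)^k$), and $C_{\alpha_1,\dots,\alpha_k}^{k,m,k}=0$ (the coefficient of $(d/dz)^0$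 in $A^k$ is $0$). *)

theory Defs
  imports "HOL-Complex_Analysis.Complex_Analysis"
begin

(* A tuple (\<alpha>_1, ..., \<alpha>_q) is encoded as a function on nat that vanishes outside {1..q},
   so that every tuple has exactly one representative and the set is finite. *)
definition index_tuples :: "nat \<Rightarrow> nat \<Rightarrow> (nat \<Rightarrow> nat) set" where
  "index_tuples p q = {\<alpha>. (\<forall>i. i \<notin> {1..q} \<longrightarrow> \<alpha> i = 0)
     \<and> (\<Sum>i=1..q. \<alpha> i) = p \<and> (\<Sum>i=1..q. i * \<alpha> i) = q}"

definition diff_op :: "(complex \<Rightarrow> complex) \<Rightarrow> (complex \<Rightarrow> complex) \<Rightarrow> complex \<Rightarrow> complex" where
  "diff_op u f = (\<lambda>z. u z * deriv f z)"

(* The operator identity is read as an identity between operators on meromorphic functions f,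
   compared at every point where both u and f are analytic: elsewhere the values of deriv carry
   no information. Entire functions u are included, being meromorphic. *)
definition expansion_coeffs :: "nat \<Rightarrow> (nat \<Rightarrow> nat \<Rightarrow> (nat \<Rightarrow> nat) \<Rightarrow> complex) \<Rightarrow> bool" where
  "expansion_coeffs k c \<longleftrightarrow>
     (\<forall>u f z. u meromorphic_on UNIV \<longrightarrow> f meromorphic_on UNIV \<longrightarrow>
        u analytic_on {z} \<longrightarrow> f analytic_on {z} \<longrightarrow>
        (diff_op u ^^ k) f z =
          u z ^ k * (deriv ^^ k) f z
          + (\<Sum>s\<in>{1..<k}.
               (\<Sum>m=1..s. u z ^ (k - m) *
                  (\<Sum>\<alpha>\<in>index_tuples m s. c s m \<alpha> * (\<Prod>i=1..s. (deriv ^^ i) u z ^ \<alpha> i)))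
               * (deriv ^^ (k - s)) f z))"

(* The operator identity only involves the indices 1 \<le> s < k, 1 \<le> m \<le> s, \<alpha> \<in> index_tuples m s.
   All other values are set to 0; this makes the description definite, and for s = k it is the
   convention that (d/dz)^0 has coefficient 0 in the k-th power of the operator. *)
definition C :: "nat \<Rightarrow> nat \<Rightarrow> nat \<Rightarrow> (nat \<Rightarrow> nat) \<Rightarrow> complex" where
  "C s m k =
     (THE c. expansion_coeffs k c \<and>
        (\<forall>s m \<alpha>. \<not> (1 \<le> s \<and> s < k \<and> 1 \<le> m \<and> m \<le> s \<and> \<alpha> \<in> index_tuples m s) \<longrightarrow> c s m \<alpha> = 0)) s m"

end

(* Both sides are the unsigned Stirling number of the first kind [k, s]. On the left, the sum over
   cycle types P(k, s), divided by k!, satisfies k P(k, s) = sum_{i=1..k} P(k - i, s - 1), and so does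
   [k, s] / k!. On the right, take u = exp: all derivatives of u at 0 are 1, so the expansion applied
   to f(z) = exp(x z) at z = 0 reads x (x+1) ... (x+k-1) = x^k + sum_s S_s x^(k-s), where S_s is the
   sum of all C^{s,m,k}. The coefficients exist because differentiation preserves degree and raises
   weight by one on differential polynomials in u; they are unique because the jets of polynomials
   u and f at 0 are arbitrary. *)

theory Submission
  imports Defs "HOL-Combinatorics.Stirling"
begin

section \<open>Tuples of given degree and weight\<close>

text \<open>A positive entry at an index \<open>i > q\<close> would alone push the weight beyond
  \<open>q\<close>, so the range may be enlarged to any \<open>N\<close> with
  \<open>q \<le> N\<close>. This puts tuples of different weights over a common range.\<close>

lemma index_tuples_iff:
  assumes "q \<le> N"
  shows "\<alpha> \<in> index_tuples p q \<longleftrightarrow>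
    (\<forall>i. i \<notin> {1..N} \<longrightarrow> \<alpha> i = 0) \<and> (\<Sum>i=1..N. \<alpha> i) = p \<and> (\<Sum>i=1..N. i * \<alpha> i) = q"
    (is "_ \<longleftrightarrow> ?R")
proof -
  have *: "(\<Sum>i=1..N. f i) = (\<Sum>i=1..q. f i)"
    if "\<And>i. i \<notin> {1..q} \<Longrightarrow> f i = 0" for f :: "nat \<Rightarrow> nat"
    using assms that by (intro sum.mono_neutral_right) auto
  show ?thesis
  proof
    assume "\<alpha> \<in> index_tuples p q"
    then show ?R
      using assms *[of \<alpha>] *[of "\<lambda>i. i * \<alpha> i"] by (auto simp: index_tuples_def)
  next
    assume R: ?R
    have "\<alpha> i = 0" if "i \<notin> {1..q}" for i
    proof (cases "i \<in> {1..N}")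
      case True
      then have "i * \<alpha> i \<le> q"
        using R member_le_sum[of i "{1..N}" "\<lambda>i. i * \<alpha> i"] by auto
      moreover have "q < i" using True that by auto
      ultimately show ?thesis by (cases "\<alpha> i") auto
    qed (use R in auto)
    then show "\<alpha> \<in> index_tuples p q"
      using R *[of \<alpha>] *[of "\<lambda>i. i * \<alpha> i"] by (auto simp: index_tuples_def)
  qed
qed

lemma prod_index_tuples:
  fixes f :: "nat \<Rightarrow> nat \<Rightarrow> 'a::comm_monoid_mult"
  assumes "\<alpha> \<in> index_tuples p q" "q \<le> N" "\<And>i. f i 0 = 1"
  shows "(\<Prod>i=1..q. f i (\<alpha> i)) = (\<Prod>i=1..N. f i (\<alpha> i))"
  using assms by (intro prod.mono_neutral_left) (auto simp: index_tuples_def)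

lemma finite_index_tuples [simp]: "finite (index_tuples p q)"
proof (rule finite_subset[OF _ finite_set_of_finite_funs])
  show "index_tuples p q \<subseteq> {f. \<forall>i. (i \<in> {1..q} \<longrightarrow> f i \<in> {..p}) \<and> (i \<notin> {1..q} \<longrightarrow> f i = 0)}"
    using member_le_sum[of _ "{1..q}"] by (auto simp: index_tuples_def)
qed simp_all

text \<open>Each index is at least 1, so the weight dominates the degree; degree 0 leaves only the
  zero tuple, whose weight is 0.\<close>

lemma index_tuples_empty:
  assumes "q < p \<or> (p = 0 \<and> 0 < q)"
  shows "index_tuples p q = {}"
proof -
  have False if \<alpha>: "\<alpha> \<in> index_tuples p q" for \<alpha>
  proof -
    have sums: "(\<Sum>i=1..q. \<alpha> i) = p" "(\<Sum>i=1..q. i * \<alpha> i) = q"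
      using \<alpha> by (simp_all add: index_tuples_def)
    have "(\<Sum>i=1..q. \<alpha> i) \<le> (\<Sum>i=1..q. i * \<alpha> i)"
      by (intro sum_mono) auto
    then have "p = 0" "0 < q" using sums assms by auto
    then have "(\<Sum>i=1..q. i * \<alpha> i) = (\<Sum>i=1..q. 0)"
      using sums(1) by (intro sum.cong) auto
    then show False using sums(2) \<open>0 < q\<close> by simp
  qed
  then show ?thesis by blast
qed

lemma index_tuples_00: "index_tuples 0 0 = {\<lambda>_. 0}"
  by (auto simp: index_tuples_def fun_eq_iff)

lemma sum_fun_upd:
  fixes g :: "nat \<Rightarrow> nat \<Rightarrow> 'a::comm_monoid_add"
  assumes "i \<in> A" "finite A"
  shows "(\<Sum>j\<in>A. g j ((\<alpha>(i := x)) j)) = g i x + (\<Sum>j\<in>A - {i}. g j (\<alpha> j))"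
  using assms by (simp add: sum.remove)

lemma prod_fun_upd:
  fixes g :: "nat \<Rightarrow> nat \<Rightarrow> 'a::comm_monoid_mult"
  assumes "i \<in> A" "finite A"
  shows "(\<Prod>j\<in>A. g j ((\<alpha>(i := x)) j)) = g i x * (\<Prod>j\<in>A - {i}. g j (\<alpha> j))"
  using assms by (simp add: prod.remove)

text \<open>Serves twice: as the insertion of a cycle of length \<open>i\<close> into a cycle type,
  and as the multiplication of a differential monomial by an \<open>i\<close>-th derivative.\<close>

lemma index_tuples_incr:
  assumes "1 \<le> i" "\<alpha> \<in> index_tuples p q"
  shows "\<alpha>(i := Suc (\<alpha> i)) \<in> index_tuples (Suc p) (q + i)"
proof -
  have i: "i \<in> {1..q+i}" using assms by auto
  have "(\<forall>j. j \<notin> {1..q+i} \<longrightarrow> \<alpha> j = 0) \<and> (\<Sum>j=1..q+i. \<alpha> j) = p \<and> (\<Sum>j=1..q+i. j * \<alpha> j) = q"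
    using assms(2) by (subst (asm) index_tuples_iff[where N = "q+i"]) auto
  then show ?thesis
    using i sum_fun_upd[OF i, of "\<lambda>j x. x" \<alpha> "Suc (\<alpha> i)"]
      sum_fun_upd[OF i, of "\<lambda>j x. j * x" \<alpha> "Suc (\<alpha> i)"]
      sum.remove[OF _ i, of \<alpha>] sum.remove[OF _ i, of "\<lambda>j. j * \<alpha> j"]
    by (subst index_tuples_iff[where N = "q+i"]) auto
qed

lemma index_tuples_decr:
  assumes "\<beta> \<in> index_tuples (Suc p) q" "0 < \<beta> i"
  shows "\<beta>(i := \<beta> i - 1) \<in> index_tuples p (q - i)"
proof -
  have i: "i \<in> {1..q}" using assms by (auto simp: index_tuples_def)
  obtain b where b: "\<beta> i = Suc b" using assms(2) by (cases "\<beta> i") auto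
  have "(\<forall>j. j \<notin> {1..q} \<longrightarrow> \<beta> j = 0) \<and> (\<Sum>j=1..q. \<beta> j) = Suc p \<and> (\<Sum>j=1..q. j * \<beta> j) = q"
    using assms(1) by (auto simp: index_tuples_def)
  then show ?thesis
    using i b sum_fun_upd[OF i, of "\<lambda>j x. x" \<beta> b]
      sum_fun_upd[OF i, of "\<lambda>j x. j * x" \<beta> b]
      sum.remove[OF _ i, of \<beta>] sum.remove[OF _ i, of "\<lambda>j. j * \<beta> j"]
    by (subst index_tuples_iff[where N = q]) auto
qed

section \<open>Cycle types and Stirling numbers of the first kind\<close>

text \<open>For \<open>\<alpha>\<close> of weight \<open>k\<close> this is the proportion of
  permutations of \<open>k\<close> points that have \<open>\<alpha> i\<close> cycles of length
  \<open>i\<close> for every \<open>i\<close> (Cauchy's formula).\<close>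

definition cycle_weight :: "nat \<Rightarrow> (nat \<Rightarrow> nat) \<Rightarrow> 'a::field_char_0" where
  "cycle_weight k \<alpha> = 1 / (\<Prod>i=1..k. of_nat i ^ \<alpha> i * fact (\<alpha> i))"

definition cycle_sum :: "nat \<Rightarrow> nat \<Rightarrow> 'a::field_char_0" where
  "cycle_sum k s = (\<Sum>\<alpha>\<in>index_tuples s k. cycle_weight k \<alpha>)"

text \<open>Lowering \<open>\<beta> i\<close> by one removes a factor \<open>i\<close> from the
  power and a factor \<open>\<beta> i\<close> from the factorial in the denominator.\<close>

lemma cycle_weight_decr:
  assumes "\<beta> \<in> index_tuples (Suc p) q" "0 < \<beta> i"
  shows "of_nat (i * \<beta> i) * cycle_weight q \<beta>
       = (cycle_weight (q - i) (\<beta>(i := \<beta> i - 1)) :: 'a::field_char_0)"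
proof -
  let ?g = "\<lambda>i x. of_nat i ^ x * fact x :: 'a"
  have i: "i \<in> {1..q}" using assms by (auto simp: index_tuples_def)
  obtain b where b: "\<beta> i = Suc b" using assms(2) by (cases "\<beta> i") auto
  have "(\<Prod>j=1..q-i. ?g j ((\<beta>(i := b)) j)) = (\<Prod>j=1..q. ?g j ((\<beta>(i := b)) j))"
    using index_tuples_decr[OF assms] b
    by (intro prod_index_tuples[where p = p and f = ?g and \<alpha> = "\<beta>(i := b)"]) auto
  also have "\<dots> = ?g i b * (\<Prod>j\<in>{1..q}-{i}. ?g j (\<beta> j))"
    using i by (intro prod_fun_upd) auto
  finally have 1: "(\<Prod>j=1..q-i. ?g j ((\<beta>(i := b)) j)) = ?g i b * (\<Prod>j\<in>{1..q}-{i}. ?g j (\<beta> j))" .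
  have 2: "(\<Prod>j=1..q. ?g j (\<beta> j)) = ?g i (Suc b) * (\<Prod>j\<in>{1..q}-{i}. ?g j (\<beta> j))"
    using i b by (simp add: prod.remove)
  have nz: "(\<Prod>j\<in>{1..q}-{i}. ?g j (\<beta> j)) \<noteq> 0" "of_nat i \<noteq> (0::'a)" "of_nat (Suc b) \<noteq> (0::'a)"
    using i by (auto simp del: of_nat_Suc)
  show ?thesis
    unfolding cycle_weight_def b diff_Suc_1 1 2
    using nz by (simp add: divide_simps del: of_nat_Suc mult_Suc_right)
qed

text \<open>Write \<open>k\<close> as the weight of each tuple, that is as the sum of all
  \<open>i * \<beta> i\<close>, and swap the sums; the inner sum for \<open>i\<close> then removes
  one cycle of length \<open>i\<close>.\<close>

lemma cycle_sum_recurrence: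
  "of_nat k * cycle_sum k (Suc s) = (\<Sum>i=1..k. cycle_sum (k - i) s :: 'a::field_char_0)"
proof -
  have "of_nat k * cycle_weight k \<beta> = (\<Sum>i=1..k. of_nat (i * \<beta> i) * cycle_weight k \<beta> :: 'a)"
    if "\<beta> \<in> index_tuples (Suc s) k" for \<beta>
  proof -
    have "of_nat k = (of_nat (\<Sum>i=1..k. i * \<beta> i) :: 'a)"
      using that by (simp add: index_tuples_def)
    then show ?thesis by (simp only: of_nat_sum sum_distrib_right)
  qed
  then have "of_nat k * cycle_sum k (Suc s)
      = (\<Sum>\<beta>\<in>index_tuples (Suc s) k. \<Sum>i=1..k. of_nat (i * \<beta> i) * cycle_weight k \<beta> :: 'a)"
    by (simp add: cycle_sum_def sum_distrib_left)
  also have "\<dots> = (\<Sum>i=1..k. \<Sum>\<beta>\<in>index_tuples (Suc s) k. of_nat (i * \<beta> i) * cycle_weight k \<beta>)"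
    by (rule sum.swap)
  also have "\<dots> = (\<Sum>i=1..k. cycle_sum (k - i) s)"
  proof (rule sum.cong)
    fix i assume i: "i \<in> {1..k}"
    \<comment> \<open>Tuples with \<open>\<beta> i = 0\<close> contribute nothing, and on the others
      lowering entry \<open>i\<close> is a bijection.\<close>
    have "(\<Sum>\<beta>\<in>index_tuples (Suc s) k. of_nat (i * \<beta> i) * cycle_weight k \<beta> :: 'a)
        = (\<Sum>\<beta>\<in>{\<beta>\<in>index_tuples (Suc s) k. 0 < \<beta> i}. of_nat (i * \<beta> i) * cycle_weight k \<beta>)"
      by (intro sum.mono_neutral_right) auto
    also have "\<dots> = (\<Sum>\<alpha>\<in>index_tuples s (k - i). cycle_weight (k - i) \<alpha>)"
    proof (rule sum.reindex_bij_witness[where i = "\<lambda>\<alpha>. \<alpha>(i := Suc (\<alpha> i))" and j = "\<lambda>\<beta>. \<beta>(i := \<beta> i - 1)"])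
      fix \<alpha> assume "\<alpha> \<in> index_tuples s (k - i)"
      then show "\<alpha>(i := Suc (\<alpha> i)) \<in> {\<beta> \<in> index_tuples (Suc s) k. 0 < \<beta> i}"
        using index_tuples_incr[of i \<alpha> s "k - i"] i by auto
    qed (auto simp: index_tuples_decr cycle_weight_decr simp del: of_nat_mult One_nat_def)
    finally show "(\<Sum>\<beta>\<in>index_tuples (Suc s) k. of_nat (i * \<beta> i) * cycle_weight k \<beta> :: 'a)
        = cycle_sum (k - i) s"
      by (simp add: cycle_sum_def)
  qed simp
  finally show ?thesis .
qed

text \<open>Dividing \<open>stirling (Suc k) (Suc s) = k * stirling k (Suc s) + stirling k s\<close>
  by \<open>fact k\<close> shows that passing from \<open>k\<close> to \<open>Suc k\<close> adds
  exactly the new last summand on the right.\<close>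

lemma stirling_recurrence:
  "of_nat k * (of_nat (stirling k (Suc s)) / fact k)
     = (\<Sum>i<k. of_nat (stirling i s) / fact i :: 'a::field_char_0)"
proof (induction k)
  case (Suc k)
  have "(of_nat (Suc k) :: 'a) \<noteq> 0" by (simp del: of_nat_Suc)
  then have "of_nat (Suc k) * (of_nat (stirling (Suc k) (Suc s)) / fact (Suc k) :: 'a)
      = of_nat k * (of_nat (stirling k (Suc s)) / fact k) + of_nat (stirling k s) / fact k"
    by (simp add: divide_simps del: of_nat_Suc)
  then show ?case using Suc by simp
qed simp

lemma cycle_sum_eq: "cycle_sum k s = (of_nat (stirling k s) / fact k :: 'a::field_char_0)"
proof (induction k arbitrary: s rule: less_induct)
  case (less k)
  \<comment> \<open>The recurrence determines the value only for positive \<open>k\<close> and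
    \<open>s\<close>; the other cases are boundary values.\<close>
  consider "k = 0" "s = 0" | "k = 0" "0 < s" | "0 < k" "s = 0" | s' where "0 < k" "s = Suc s'"
    by (cases s; cases k) auto
  then show ?case
  proof cases
    case 1
    then show ?thesis by (simp add: cycle_sum_def cycle_weight_def index_tuples_00)
  next
    case 2
    then show ?thesis by (simp add: cycle_sum_def index_tuples_empty)
  next
    case 3
    then show ?thesis by (simp add: cycle_sum_def index_tuples_empty)
  next
    case 4
    have "of_nat k * cycle_sum k s = (\<Sum>i=1..k. cycle_sum (k - i) s' :: 'a)"
      unfolding 4 by (rule cycle_sum_recurrence)
    also have "\<dots> = (\<Sum>i<k. cycle_sum i s')"
      by (rule sum.reindex_bij_witness[where i = "\<lambda>i. k - i" and j = "\<lambda>i. k - i"]) auto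
    also have "\<dots> = (\<Sum>i<k. of_nat (stirling i s') / fact i)"
      using less by simp
    also have "\<dots> = of_nat k * (of_nat (stirling k s) / fact k)"
      unfolding 4 by (rule stirling_recurrence[symmetric])
    finally show ?thesis using 4(1) by (subst (asm) mult_left_cancel) auto
  qed
qed

section \<open>Existence of the expansion\<close>

definition jet :: "(complex \<Rightarrow> complex) \<Rightarrow> complex \<Rightarrow> nat \<Rightarrow> complex" where
  "jet u z i = (deriv ^^ i) u z"

text \<open>Differential polynomials \<open>g\<close> of degree \<open>d\<close> and weight \<open>s\<close>, viewed as functions of the jet
  \<open>a = (u, u', u'', \<dots>)\<close>; the \<open>i\<close>-th derivative has weight \<open>i\<close>.\<close>

inductive diff_poly :: "nat \<Rightarrow> nat \<Rightarrow> ((nat \<Rightarrow> complex) \<Rightarrow> complex) \<Rightarrow> bool" where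
  diff_poly_zero: "diff_poly d s (\<lambda>_. 0)"
| diff_poly_one: "diff_poly 0 0 (\<lambda>_. 1)"
| diff_poly_mult: "diff_poly d s g \<Longrightarrow> diff_poly (Suc d) (s + i) (\<lambda>a. a i * g a)"
| diff_poly_add: "diff_poly d s g \<Longrightarrow> diff_poly d s h \<Longrightarrow> diff_poly d s (\<lambda>a. g a + h a)"

lemma jet_has_derivative:
  assumes "open S" "u holomorphic_on S" "z \<in> S"
  shows "((\<lambda>w. jet u w i) has_field_derivative jet u z (Suc i)) (at z)"
  using holomorphic_derivI[OF holomorphic_higher_deriv[OF assms(2,1), of i] assms(1,3)]
  by (simp add: jet_def[abs_def])

text \<open>By the Leibniz rule, each term of the derivative replaces one factor \<open>a i\<close>
  by \<open>a (Suc i)\<close>: the degree stays and the weight grows by one. Choosing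
  \<open>g'\<close> before \<open>u\<close>, \<open>S\<close> and \<open>z\<close> is what makes the
  coefficients universal.\<close>

lemma diff_poly_deriv:
  assumes "diff_poly d s g"
  shows "\<exists>g'. diff_poly d (Suc s) g' \<and>
    (\<forall>u S z. open S \<longrightarrow> u holomorphic_on S \<longrightarrow> z \<in> S \<longrightarrow>
      ((\<lambda>w. g (jet u w)) has_field_derivative g' (jet u z)) (at z))"
  using assms
proof induction
  case (diff_poly_zero d s)
  show ?case by (intro exI[of _ "\<lambda>_. 0"]) (auto intro: diff_poly.intros)
next
  case diff_poly_one
  show ?case by (intro exI[of _ "\<lambda>_. 0"]) (auto intro: diff_poly.intros)
next
  case (diff_poly_mult d s g i)
  then obtain g' where g': "diff_poly d (Suc s) g'"
    "\<And>u S z. open S \<Longrightarrow> u holomorphic_on S \<Longrightarrow> z \<in> S \<Longrightarrow>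
      ((\<lambda>w. g (jet u w)) has_field_derivative g' (jet u z)) (at z)"
    by blast
  have "diff_poly (Suc d) (Suc (s + i)) (\<lambda>a. a (Suc i) * g a + a i * g' a)"
    using diff_poly.diff_poly_mult[OF diff_poly_mult(1), of "Suc i"]
      diff_poly.diff_poly_mult[OF g'(1), of i]
    by (intro diff_poly_add) auto
  then show ?case
    by (intro exI[of _ "\<lambda>a. a (Suc i) * g a + a i * g' a"])
       (auto intro!: derivative_eq_intros jet_has_derivative g'(2) simp: algebra_simps)
next
  case (diff_poly_add d s g h)
  then obtain g' h' where "diff_poly d (Suc s) g'" "diff_poly d (Suc s) h'"
    "\<And>u S z. open S \<Longrightarrow> u holomorphic_on S \<Longrightarrow> z \<in> S \<Longrightarrow>
      ((\<lambda>w. g (jet u w)) has_field_derivative g' (jet u z)) (at z)"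
    "\<And>u S z. open S \<Longrightarrow> u holomorphic_on S \<Longrightarrow> z \<in> S \<Longrightarrow>
      ((\<lambda>w. h (jet u w)) has_field_derivative h' (jet u z)) (at z)"
    by blast
  then show ?case
    by (intro exI[of _ "\<lambda>a. g' a + h' a"]) (auto intro!: diff_poly.diff_poly_add DERIV_add)
qed

text \<open>Applying \<open>u d/dz\<close> to a term, the derivative falls either on the derivative
  of \<open>f\<close> or on \<open>g s\<close>. In every term \<open>f\<close> is differentiated at
  least once, hence \<open>s < k\<close>.\<close>

lemma diff_op_power_expansion:
  assumes "1 \<le> k"
  shows "\<exists>g. (\<forall>s<k. diff_poly k s (g s)) \<and> (\<forall>a. g 0 a = a 0 ^ k) \<and>
    (\<forall>u f S z. open S \<longrightarrow> u holomorphic_on S \<longrightarrow> f holomorphic_on S \<longrightarrow> z \<in> S \<longrightarrow>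
      (diff_op u ^^ k) f z = (\<Sum>s<k. g s (jet u z) * jet f z (k - s)))"
  using assms
proof (induction k rule: nat_induct_at_least)
  case base
  have "diff_poly 1 0 (\<lambda>a. a 0 * 1)"
    using diff_poly_mult[OF diff_poly_one, of 0] by simp
  then show ?case
    by (intro exI[of _ "\<lambda>s a. a 0 * 1"]) (auto simp: diff_op_def jet_def)
next
  case (Suc k)
  then obtain g where g: "\<And>s. s < k \<Longrightarrow> diff_poly k s (g s)" "\<And>a. g 0 a = a 0 ^ k"
    "\<And>u f S z. open S \<Longrightarrow> u holomorphic_on S \<Longrightarrow> f holomorphic_on S \<Longrightarrow> z \<in> S \<Longrightarrow>
      (diff_op u ^^ k) f z = (\<Sum>s<k. g s (jet u z) * jet f z (k - s))"
    by blast
  obtain g' where g': "\<And>s. s < k \<Longrightarrow> diff_poly k (Suc s) (g' s)"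
    "\<And>s u S z. s < k \<Longrightarrow> open S \<Longrightarrow> u holomorphic_on S \<Longrightarrow> z \<in> S \<Longrightarrow>
      ((\<lambda>w. g s (jet u w)) has_field_derivative g' s (jet u z)) (at z)"
    using diff_poly_deriv[OF g(1)] by metis
  \<comment> \<open>Index \<open>s\<close> collects the old \<open>g s\<close>, where
    \<open>f\<close> was differentiated, and the derivative of \<open>g (s - 1)\<close>. The zeros
    cover the ends: there is no \<open>g k\<close> and nothing precedes \<open>g 0\<close>.\<close>
  define h where "h = (\<lambda>s a. a 0 * ((if s < k then g s a else 0) + (if s = 0 then 0 else g' (s - 1) a)))"
  have "diff_poly (Suc k) s (h s)" if "s < Suc k" for s
  proof -
    have "diff_poly k s (\<lambda>a. if s < k then g s a else 0)"
      by (cases "s < k") (auto intro: diff_poly_zero g(1))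
    moreover have "diff_poly k s (\<lambda>a. if s = 0 then 0 else g' (s - 1) a)"
      using g'(1)[of "s - 1"] that by (cases s) (auto intro: diff_poly_zero)
    ultimately show ?thesis
      unfolding h_def using diff_poly_mult[OF diff_poly_add, of k s _ _ 0] by simp
  qed
  moreover have "h 0 a = a 0 ^ Suc k" for a
    using Suc.hyps g(2) by (simp add: h_def)
  moreover have "(diff_op u ^^ Suc k) f z = (\<Sum>s<Suc k. h s (jet u z) * jet f z (Suc k - s))"
    if S: "open S" "u holomorphic_on S" "f holomorphic_on S" "z \<in> S" for u f S z
  proof -
    let ?a = "jet u z" and ?b = "jet f z"
    have "((\<lambda>w. \<Sum>s<k. g s (jet u w) * jet f w (k - s)) has_field_derivative
        (\<Sum>s<k. g s ?a * ?b (Suc k - s) + g' s ?a * ?b (k - s))) (at z)"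
      by (rule DERIV_sum, rule DERIV_cong[OF DERIV_mult])
         (use S in \<open>auto intro!: g'(2) jet_has_derivative simp: Suc_diff_le\<close>)
    \<comment> \<open>The induction hypothesis holds on the whole open set \<open>S\<close>, so both
      sides have the same derivative at \<open>z\<close>.\<close>
    then have "((diff_op u ^^ k) f has_field_derivative
        (\<Sum>s<k. g s ?a * ?b (Suc k - s) + g' s ?a * ?b (k - s))) (at z)"
      by (rule has_field_derivative_transform_within_open[OF _ S(1,4)])
         (use g(3)[OF S(1-3)] in auto)
    then have "(diff_op u ^^ Suc k) f z
        = ?a 0 * (\<Sum>s<k. g s ?a * ?b (Suc k - s) + g' s ?a * ?b (k - s))"
      by (simp add: diff_op_def[of u "(diff_op u ^^ k) f"] DERIV_imp_deriv jet_def)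
    also have "\<dots> = (\<Sum>s<k. ?a 0 * g s ?a * ?b (Suc k - s)) + (\<Sum>s<k. ?a 0 * g' s ?a * ?b (k - s))"
      by (simp add: sum.distrib sum_distrib_left algebra_simps)
    also have "(\<Sum>s<k. ?a 0 * g s ?a * ?b (Suc k - s))
        = (\<Sum>s<Suc k. ?a 0 * (if s < k then g s ?a else 0) * ?b (Suc k - s))"
      by (simp add: sum.lessThan_Suc)
    \<comment> \<open>Here \<open>f\<close> keeps its order \<open>k - s = Suc k - Suc s\<close>, so
      the term belongs to index \<open>Suc s\<close>.\<close>
    also have "(\<Sum>s<k. ?a 0 * g' s ?a * ?b (k - s))
        = (\<Sum>s<Suc k. ?a 0 * (if s = 0 then 0 else g' (s - 1) ?a) * ?b (Suc k - s))"
      by (subst sum.lessThan_Suc_shift) simp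
    finally show ?thesis
      by (simp only: h_def distrib_left distrib_right sum.distrib)
  qed
  ultimately show ?case by blast
qed

section \<open>Normal form of differential polynomials as sums over tuples\<close>

definition tuple_monomial :: "nat \<Rightarrow> nat \<Rightarrow> nat \<Rightarrow> (nat \<Rightarrow> nat) \<Rightarrow> (nat \<Rightarrow> complex) \<Rightarrow> complex" where
  "tuple_monomial d s m \<alpha> a = a 0 ^ (d - m) * (\<Prod>i=1..s. a i ^ \<alpha> i)"

text \<open>The tuple records only derivatives of order at least 1, and the power of
  \<open>a 0\<close> fills the degree up to \<open>d\<close>. Letting \<open>m\<close> run up to
  \<open>d\<close> instead of \<open>s\<close> includes weight 0 and keeps the closure proofs
  uniform.\<close>

definition tuple_polynomial :: "nat \<Rightarrow> nat \<Rightarrow> ((nat \<Rightarrow> complex) \<Rightarrow> complex) \<Rightarrow> bool" where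
  "tuple_polynomial d s g \<longleftrightarrow>
    (\<exists>c. \<forall>a. g a = (\<Sum>m\<le>d. \<Sum>\<alpha>\<in>index_tuples m s. c m \<alpha> * tuple_monomial d s m \<alpha> a))"

lemma tuple_polynomial_zero: "tuple_polynomial d s (\<lambda>_. 0)"
  unfolding tuple_polynomial_def by (intro exI[of _ "\<lambda>_ _. 0"]) simp

lemma tuple_polynomial_add:
  assumes "tuple_polynomial d s g" "tuple_polynomial d s h"
  shows "tuple_polynomial d s (\<lambda>a. g a + h a)"
proof -
  obtain c c' where "\<And>a. g a = (\<Sum>m\<le>d. \<Sum>\<alpha>\<in>index_tuples m s. c m \<alpha> * tuple_monomial d s m \<alpha> a)"
    "\<And>a. h a = (\<Sum>m\<le>d. \<Sum>\<alpha>\<in>index_tuples m s. c' m \<alpha> * tuple_monomial d s m \<alpha> a)"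
    using assms unfolding tuple_polynomial_def by blast
  then show ?thesis
    unfolding tuple_polynomial_def
    by (intro exI[of _ "\<lambda>m \<alpha>. c m \<alpha> + c' m \<alpha>"]) (simp add: sum.distrib distrib_right)
qed

lemma tuple_polynomial_sum:
  assumes "\<And>x. x \<in> X \<Longrightarrow> tuple_polynomial d s (g x)"
  shows "tuple_polynomial d s (\<lambda>a. \<Sum>x\<in>X. g x a)"
  using assms
  by (induction X rule: infinite_finite_induct)
     (auto intro: tuple_polynomial_zero tuple_polynomial_add)

lemma tuple_polynomial_monomial:
  assumes "m \<le> d" "\<alpha> \<in> index_tuples m s"
  shows "tuple_polynomial d s (\<lambda>a. x * tuple_monomial d s m \<alpha> a)"
proof -
  have "(\<Sum>m'\<le>d. \<Sum>\<alpha>'\<in>index_tuples m' s.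
      (if m' = m then if \<alpha>' = \<alpha> then x else 0 else 0) * tuple_monomial d s m' \<alpha>' a)
      = x * tuple_monomial d s m \<alpha> a" for a
  proof -
    have "(\<Sum>\<alpha>'\<in>index_tuples m' s.
        (if m' = m then if \<alpha>' = \<alpha> then x else 0 else 0) * tuple_monomial d s m' \<alpha>' a)
        = (if m' = m then x * tuple_monomial d s m \<alpha> a else 0)" for m'
      using assms(2) by (auto simp: if_distrib[of "\<lambda>y. y * _"] sum.delta cong: if_cong)
    then show ?thesis using assms(1) by simp
  qed
  then show ?thesis
    unfolding tuple_polynomial_def
    by (intro exI[of _ "\<lambda>m' \<alpha>'. if m' = m then if \<alpha>' = \<alpha> then x else 0 else 0"]) simp
qed

text \<open>For \<open>i = 0\<close> only the power of \<open>a 0\<close> grows. For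
  \<open>i > 0\<close> entry \<open>i\<close> of the tuple grows, and \<open>d\<close> and
  \<open>m\<close> rise together, so the power of \<open>a 0\<close> is unchanged.\<close>

lemma tuple_polynomial_mult:
  assumes "tuple_polynomial d s g"
  shows "tuple_polynomial (Suc d) (s + i) (\<lambda>a. a i * g a)"
proof -
  obtain c where c: "\<And>a. g a = (\<Sum>m\<le>d. \<Sum>\<alpha>\<in>index_tuples m s. c m \<alpha> * tuple_monomial d s m \<alpha> a)"
    using assms unfolding tuple_polynomial_def by blast
  have "tuple_polynomial (Suc d) (s + i) (\<lambda>a. a i * (c m \<alpha> * tuple_monomial d s m \<alpha> a))"
    if "m \<le> d" "\<alpha> \<in> index_tuples m s" for m \<alpha>
  proof (cases "i = 0")
    case True
    then have *: "a i * (c m \<alpha> * tuple_monomial d s m \<alpha> a) = c m \<alpha> * tuple_monomial (Suc d) s m \<alpha> a" for a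
      using that by (simp add: tuple_monomial_def Suc_diff_le)
    show ?thesis
      unfolding * using True tuple_polynomial_monomial[of m "Suc d" \<alpha> s "c m \<alpha>"] that by simp
  next
    case False
    let ?\<beta> = "\<alpha>(i := Suc (\<alpha> i))"
    have "a i * tuple_monomial d s m \<alpha> a = tuple_monomial (Suc d) (s + i) (Suc m) ?\<beta> a" for a
    proof -
      have "(\<Prod>j=1..s. a j ^ \<alpha> j) = (\<Prod>j=1..s+i. a j ^ \<alpha> j)"
        using that by (intro prod_index_tuples[where f = "\<lambda>j x. a j ^ x"]) auto
      also have "a i * \<dots> = (\<Prod>j=1..s+i. a j ^ ?\<beta> j)"
        using False by (subst (1 2) prod.remove[of _ i]) auto
      finally show ?thesis by (simp add: tuple_monomial_def)
    qed
    then have *: "a i * (c m \<alpha> * tuple_monomial d s m \<alpha> a)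
        = c m \<alpha> * tuple_monomial (Suc d) (s + i) (Suc m) ?\<beta> a" for a
      by (metis mult.left_commute)
    show ?thesis
      unfolding * using False that tuple_polynomial_monomial[of "Suc m" "Suc d" ?\<beta> "s + i" "c m \<alpha>"]
        index_tuples_incr[of i \<alpha> m s] by simp
  qed
  then show ?thesis
    unfolding c sum_distrib_left by (intro tuple_polynomial_sum) auto
qed

lemma diff_poly_imp_tuple_polynomial: "diff_poly d s g \<Longrightarrow> tuple_polynomial d s g"
proof (induction rule: diff_poly.induct)
  case diff_poly_one
  show ?case
    using tuple_polynomial_monomial[of 0 0 "\<lambda>_. 0" 0 1]
    by (simp add: index_tuples_00 tuple_monomial_def)
qed (auto intro: tuple_polynomial_zero tuple_polynomial_add tuple_polynomial_mult)

lemma expansion_coeffs_exist: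
  assumes "1 \<le> k"
  shows "\<exists>c. expansion_coeffs k c"
proof -
  obtain g where g: "\<And>s. s < k \<Longrightarrow> diff_poly k s (g s)" "\<And>a. g 0 a = a 0 ^ k"
    "\<And>u f S z. open S \<Longrightarrow> u holomorphic_on S \<Longrightarrow> f holomorphic_on S \<Longrightarrow> z \<in> S \<Longrightarrow>
      (diff_op u ^^ k) f z = (\<Sum>s<k. g s (jet u z) * jet f z (k - s))"
    using diff_op_power_expansion[OF assms] by blast
  have "\<forall>s\<in>{..<k}. \<exists>c. \<forall>a. g s a = (\<Sum>m\<le>k. \<Sum>\<alpha>\<in>index_tuples m s. c m \<alpha> * tuple_monomial k s m \<alpha> a)"
    using diff_poly_imp_tuple_polynomial[OF g(1)] by (auto simp: tuple_polynomial_def)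
  from bchoice[OF this] obtain c where c: "\<And>s a. s < k \<Longrightarrow>
      g s a = (\<Sum>m\<le>k. \<Sum>\<alpha>\<in>index_tuples m s. c s m \<alpha> * tuple_monomial k s m \<alpha> a)"
    by auto
  \<comment> \<open>For \<open>s \<ge> 1\<close> there are no tuples with \<open>m = 0\<close> or
    \<open>m > s\<close>, which leaves the range of the required expansion.\<close>
  have gs: "g s a = (\<Sum>m=1..s. a 0 ^ (k - m) * (\<Sum>\<alpha>\<in>index_tuples m s. c s m \<alpha> * (\<Prod>i=1..s. a i ^ \<alpha> i)))"
    if "s \<in> {1..<k}" for s a
  proof -
    have "(\<Sum>m\<le>k. \<Sum>\<alpha>\<in>index_tuples m s. c s m \<alpha> * tuple_monomial k s m \<alpha> a)
        = (\<Sum>m=1..s. \<Sum>\<alpha>\<in>index_tuples m s. c s m \<alpha> * tuple_monomial k s m \<alpha> a)"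
    proof (rule sum.mono_neutral_right)
      show "\<forall>m\<in>{..k} - {1..s}. (\<Sum>\<alpha>\<in>index_tuples m s. c s m \<alpha> * tuple_monomial k s m \<alpha> a) = 0"
        using that by (auto simp: index_tuples_empty not_le)
    qed (use that in auto)
    then show ?thesis
      using that c[of s a] by (simp add: tuple_monomial_def sum_distrib_left mult_ac)
  qed
  have "(diff_op u ^^ k) f z = u z ^ k * (deriv ^^ k) f z
      + (\<Sum>s\<in>{1..<k}. (\<Sum>m=1..s. u z ^ (k - m) *
          (\<Sum>\<alpha>\<in>index_tuples m s. c s m \<alpha> * (\<Prod>i=1..s. (deriv ^^ i) u z ^ \<alpha> i)))
          * (deriv ^^ (k - s)) f z)"
    if uf: "u analytic_on {z}" "f analytic_on {z}" for u f z
  proof -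
    \<comment> \<open>Analyticity at \<open>z\<close> supplies neighbourhoods of \<open>z\<close>;
      the expansion is applied on their intersection.\<close>
    obtain S T where S: "open S" "z \<in> S" "u holomorphic_on S" and T: "open T" "z \<in> T" "f holomorphic_on T"
      using uf by (auto simp: analytic_at)
    have "(diff_op u ^^ k) f z = (\<Sum>s<k. g s (jet u z) * jet f z (k - s))"
      by (rule g(3)[of "S \<inter> T"]) (use S T in \<open>auto intro: holomorphic_on_subset\<close>)
    also have "{..<k} = insert 0 {1..<k}" using assms by auto
    finally show ?thesis
      using gs by (simp add: g(2) jet_def)
  qed
  then show ?thesis
    unfolding expansion_coeffs_def by blast
qed

section \<open>Uniqueness of the expansion\<close>

text \<open>Induction on the variables: as a polynomial in the variable \<open>j\<close> alone, the
  sum has vanishing coefficients, and these are polynomials in the remaining variables. The third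
  assumption ensures that different exponents in \<open>A\<close> give different monomials on
  \<open>I\<close>.\<close>

lemma multivariate_polynomial_zero:
  fixes c :: "('i \<Rightarrow> nat) \<Rightarrow> 'a::{idom,real_normed_div_algebra}"
  assumes "finite I" "finite A"
    and "\<And>\<alpha> \<beta>. \<alpha> \<in> A \<Longrightarrow> \<beta> \<in> A \<Longrightarrow> (\<And>i. i \<in> I \<Longrightarrow> \<alpha> i = \<beta> i) \<Longrightarrow> \<alpha> = \<beta>"
    and "\<And>w. (\<Sum>\<alpha>\<in>A. c \<alpha> * (\<Prod>i\<in>I. w i ^ \<alpha> i)) = 0"
    and "\<alpha> \<in> A"
  shows "c \<alpha> = 0"
  using assms
proof (induction I arbitrary: A \<alpha> rule: finite_induct)
  case empty
  \<comment> \<open>Without variables, all members of \<open>A\<close> agree on \<open>I\<close> and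
    hence coincide.\<close>
  then have "A = {\<alpha>}" by blast
  then show ?case using empty.prems(3) by simp
next
  case (insert j I)
  define e where "e = \<alpha> j"
  define N where "N = Max ((\<lambda>\<alpha>. \<alpha> j) ` A)"
  have N: "\<beta> j \<le> N" if "\<beta> \<in> A" for \<beta>
    using that insert.prems(1) by (simp add: N_def)
  have slice: "(\<Sum>\<beta>\<in>{\<beta>\<in>A. \<beta> j = e}. c \<beta> * (\<Prod>i\<in>I. w i ^ \<beta> i)) = 0" for w
  proof -
    \<comment> \<open>\<open>?p n\<close> is the coefficient of \<open>x ^ n\<close> once the
      variable \<open>j\<close> is given the value \<open>x\<close>.\<close>
    let ?p = "\<lambda>n. \<Sum>\<beta>\<in>{\<beta>\<in>A. \<beta> j = n}. c \<beta> * (\<Prod>i\<in>I. w i ^ \<beta> i)"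
    have "(\<Sum>n\<le>N. ?p n * x ^ n) = 0" for x
    proof -
      have "(\<Sum>n\<le>N. ?p n * x ^ n)
          = (\<Sum>n\<le>N. \<Sum>\<beta>\<in>{\<beta>\<in>A. \<beta> j = n}. c \<beta> * (x ^ \<beta> j * (\<Prod>i\<in>I. w i ^ \<beta> i)))"
        unfolding sum_distrib_right by (intro sum.cong refl) (auto simp: mult_ac)
      also have "\<dots> = (\<Sum>\<beta>\<in>A. c \<beta> * (x ^ \<beta> j * (\<Prod>i\<in>I. w i ^ \<beta> i)))"
        using insert.prems(1) N by (intro sum.group) auto
      also have "\<dots> = (\<Sum>\<beta>\<in>A. c \<beta> * (\<Prod>i\<in>insert j I. (w(j := x)) i ^ \<beta> i))"
      proof -
        have "(\<Prod>i\<in>I. (w(j := x)) i ^ \<beta> i) = (\<Prod>i\<in>I. w i ^ \<beta> i)" for \<beta>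
          using insert.hyps by (intro prod.cong) auto
        then show ?thesis using insert.hyps by simp
      qed
      also have "\<dots> = 0" by (rule insert.prems(3))
      finally show ?thesis .
    qed
    then have "\<forall>n\<le>N. ?p n = 0"
      using polyfun_eq_0[of ?p N] by blast
    then show ?thesis using N[OF insert.prems(4)] by (simp add: e_def)
  qed
  show ?case
  proof (intro insert.IH[of "{\<beta>\<in>A. \<beta> j = e}" \<alpha>])
    fix \<beta> \<gamma>
    assume "\<beta> \<in> {\<beta>\<in>A. \<beta> j = e}" "\<gamma> \<in> {\<beta>\<in>A. \<beta> j = e}"
      "\<And>i. i \<in> I \<Longrightarrow> \<beta> i = \<gamma> i"
    then show "\<beta> = \<gamma>" by (intro insert.prems(2)) auto
  qed (use slice insert.prems in \<open>simp_all add: e_def\<close>)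
qed

lemma higher_deriv_poly: "(deriv ^^ n) (poly p) = poly ((pderiv ^^ n) p)"
  by (induction n) (auto intro!: ext DERIV_imp_deriv poly_DERIV)

text \<open>The Taylor polynomial with coefficients \<open>w i / fact i\<close> realizes any finite
  jet at 0.\<close>

lemma poly_with_jet:
  fixes w :: "nat \<Rightarrow> complex"
  obtains p where "\<And>i. i \<le> N \<Longrightarrow> (deriv ^^ i) (poly p) 0 = w i"
proof
  define p where "p = (\<Sum>i\<le>N. monom (w i / fact i) i)"
  fix i assume "i \<le> N"
  have "coeff p i = (\<Sum>j\<le>N. if j = i then w j / fact j else 0)"
    by (simp add: p_def coeff_sum)
  with \<open>i \<le> N\<close> have "coeff p i = w i / fact i" by simp
  then show "(deriv ^^ i) (poly p) 0 = w i"
    by (simp add: higher_deriv_poly poly_0_coeff_0 coeff_higher_pderiv flip: pochhammer_fact)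
qed

lemma expansion_coeffs_unique:
  assumes "expansion_coeffs k c" "expansion_coeffs k c'"
    and s: "1 \<le> s" "s < k" and m: "1 \<le> m" "m \<le> s" and \<alpha>: "\<alpha> \<in> index_tuples m s"
  shows "c s m \<alpha> = c' s m \<alpha>"
proof -
  let ?A = "\<Union>m\<in>{1..s}. index_tuples m s"
  \<comment> \<open>The degree \<open>m\<close> can be read off from the tuple, so the tuples of all
    degrees can be pooled into one sum over \<open>?A\<close>.\<close>
  define size where "size = (\<lambda>\<alpha>. \<Sum>i=1..s. \<alpha> i :: nat)"
  have size: "size \<beta> = n" if "\<beta> \<in> index_tuples n s" for \<beta> n
    using that by (simp add: size_def index_tuples_def)
  define T where "T = (\<lambda>c t a. \<Sum>m=1..t. a 0 ^ (k - m) *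
      (\<Sum>\<alpha>\<in>index_tuples m t. c t m \<alpha> * (\<Prod>i=1..t. a i ^ \<alpha> i)) :: complex)"
  have jets: "T c s a = T c' s a" for a
  proof -
    obtain p where p: "\<And>i. i \<le> s \<Longrightarrow> (deriv ^^ i) (poly p) 0 = a i"
      using poly_with_jet by blast
    \<comment> \<open>Only the derivative of order \<open>k - s\<close> survives at 0, which
      isolates the coefficient of index \<open>s\<close>; the leading term vanishes because
      \<open>s \<ge> 1\<close>.\<close>
    obtain q where q: "\<And>i. i \<le> k \<Longrightarrow> (deriv ^^ i) (poly q) 0 = (if i = k - s then 1 else 0 :: complex)"
      using poly_with_jet[of k "\<lambda>i. if i = k - s then 1 else 0"] by blast
    have exp: "(diff_op (poly p) ^^ k) (poly q) 0 = T b s a" if "expansion_coeffs k b" for b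
    proof -
      have "poly r analytic_on UNIV" for r :: "complex poly"
        unfolding analytic_on_open[OF open_UNIV] holomorphic_on_open[OF open_UNIV]
        using poly_DERIV by blast
      then have an: "poly r meromorphic_on UNIV" "poly r analytic_on {0}" for r :: "complex poly"
        by (simp_all add: analytic_on_imp_meromorphic_on analytic_on_subset[of _ UNIV])
      have "(diff_op (poly p) ^^ k) (poly q) 0 = poly p 0 ^ k * (deriv ^^ k) (poly q) 0
          + (\<Sum>t\<in>{1..<k}. T b t (jet (poly p) 0) * (deriv ^^ (k - t)) (poly q) 0)"
        using that[unfolded expansion_coeffs_def, rule_format,
            OF an(1)[of p] an(1)[of q] an(2)[of p] an(2)[of q]]
        by (simp only: T_def jet_def funpow_0)
      also have "\<dots> = (\<Sum>t\<in>{1..<k}. if t = s then T b t (jet (poly p) 0) else 0)"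
      proof -
        have "(deriv ^^ k) (poly q) 0 = 0" using q[of k] s by simp
        moreover have "(deriv ^^ (k - t)) (poly q) 0 = (if t = s then 1 else 0)" if "t \<in> {1..<k}" for t
          using q[of "k - t"] s that by auto
        ultimately show ?thesis
          by (simp only: mult_zero_right add_0_left) (intro sum.cong refl, simp)
      qed
      also have "\<dots> = T b s (jet (poly p) 0)" using s by simp
      also have "\<dots> = T b s a"
        using p p[of 0] by (simp add: T_def jet_def)
      finally show ?thesis .
    qed
    show ?thesis using exp[OF assms(1)] exp[OF assms(2)] by simp
  qed
  \<comment> \<open>Setting \<open>u = 1\<close> at the point loses nothing: the exponent of \<open>u\<close> is determined by the tuple.\<close>
  have flat: "T b s (w(0 := 1)) = (\<Sum>\<beta>\<in>?A. b s (size \<beta>) \<beta> * (\<Prod>i\<in>{1..s}. w i ^ \<beta> i))" for b w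
  proof -
    have "(\<Sum>\<beta>\<in>?A. b s (size \<beta>) \<beta> * (\<Prod>i\<in>{1..s}. w i ^ \<beta> i))
        = (\<Sum>m=1..s. \<Sum>\<beta>\<in>index_tuples m s. b s (size \<beta>) \<beta> * (\<Prod>i\<in>{1..s}. w i ^ \<beta> i))"
      by (rule sum.UNION_disjoint) (auto dest: size)
    also have "\<dots> = T b s (w(0 := 1))"
      by (auto simp: T_def size intro!: sum.cong)
    finally show ?thesis ..
  qed
  have "c s (size \<alpha>) \<alpha> - c' s (size \<alpha>) \<alpha> = 0"
  proof (rule multivariate_polynomial_zero[where I = "{1..s}" and A = ?A and \<alpha> = \<alpha>])
    fix w show "(\<Sum>\<beta>\<in>?A. (c s (size \<beta>) \<beta> - c' s (size \<beta>) \<beta>) * (\<Prod>i\<in>{1..s}. w i ^ \<beta> i)) = 0"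
      using jets[of "w(0 := 1)"] unfolding flat by (simp add: left_diff_distrib sum_subtractf)
  next
    fix \<beta> \<gamma> assume *: "\<beta> \<in> ?A" "\<gamma> \<in> ?A" "\<And>i. i \<in> {1..s} \<Longrightarrow> \<beta> i = \<gamma> i"
    \<comment> \<open>Tuples vanish outside \<open>{1..s}\<close>, so agreement there is full
      equality.\<close>
    have "\<beta> i = \<gamma> i" for i
      using * by (cases "i \<in> {1..s}") (auto simp: index_tuples_def)
    then show "\<beta> = \<gamma>" by (rule ext)
  qed (use m \<alpha> in auto)
  then show ?thesis using size[OF \<alpha>] by simp
qed

section \<open>Well-definedness of \<open>C\<close>\<close>

lemma expansion_coeffs_cong:
  assumes "\<And>s m \<alpha>. 1 \<le> s \<Longrightarrow> s < k \<Longrightarrow> 1 \<le> m \<Longrightarrow> m \<le> s \<Longrightarrow> \<alpha> \<in> index_tuples m s \<Longrightarrow>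
    c s m \<alpha> = c' s m \<alpha>"
  shows "expansion_coeffs k c \<longleftrightarrow> expansion_coeffs k c'"
  unfolding expansion_coeffs_def using assms by simp

text \<open>The definite description in \<open>C\<close> has exactly one solution: any valid
  coefficient family, set to 0 outside the indices that the expansion reads.\<close>

lemma C_properties:
  assumes "1 \<le> k"
  shows "expansion_coeffs k (\<lambda>s m. C s m k)"
    and "\<And>s m \<alpha>. \<not> (1 \<le> s \<and> s < k \<and> 1 \<le> m \<and> m \<le> s \<and> \<alpha> \<in> index_tuples m s) \<Longrightarrow> C s m k \<alpha> = 0"
proof -
  let ?R = "\<lambda>s m \<alpha>. 1 \<le> s \<and> s < k \<and> 1 \<le> m \<and> m \<le> s \<and> \<alpha> \<in> index_tuples m s"
  let ?P = "\<lambda>c. expansion_coeffs k c \<and> (\<forall>s m \<alpha>. \<not> ?R s m \<alpha> \<longrightarrow> c s m \<alpha> = 0)"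
  obtain c where c: "expansion_coeffs k c"
    using expansion_coeffs_exist[OF assms] by blast
  have "\<exists>!c. ?P c"
  proof (rule ex1I)
    show "?P (\<lambda>s m \<alpha>. if ?R s m \<alpha> then c s m \<alpha> else 0)"
      using c by (subst expansion_coeffs_cong[of k _ c]) auto
  next
    fix b assume b: "?P b"
    then show "b = (\<lambda>s m \<alpha>. if ?R s m \<alpha> then c s m \<alpha> else 0)"
      using expansion_coeffs_unique[OF _ c, of b] by (intro ext) auto
  qed
  from theI'[OF this] have P: "?P (\<lambda>s m. C s m k)"
    unfolding C_def[abs_def] .
  then show "expansion_coeffs k (\<lambda>s m. C s m k)" by blast
  show "C s m k \<alpha> = 0" if "\<not> ?R s m \<alpha>" for s m \<alpha>
    using P that by blast
qed

section \<open>Evaluation on exponentials\<close>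

lemma higher_deriv_exp_mult: "(deriv ^^ n) (\<lambda>z. exp (x * z)) = (\<lambda>z. x ^ n * exp (x * z :: complex))"
proof (induction n)
  case (Suc n)
  then show ?case
    by (auto intro!: ext DERIV_imp_deriv derivative_eq_intros)
qed simp

text \<open>Applying \<open>exp z * d/dz\<close> to \<open>exp ((x + k) * z)\<close> yields the
  factor \<open>x + k\<close> and raises the frequency by one; the factors build up the rising
  factorial.\<close>

lemma diff_op_exp_power:
  "(diff_op exp ^^ k) (\<lambda>z. exp (x * z)) = (\<lambda>z. pochhammer x k * exp ((x + of_nat k) * z))"
proof (induction k)
  case (Suc k)
  have "deriv (\<lambda>z. pochhammer x k * exp ((x + of_nat k) * z)) z
      = pochhammer x k * (x + of_nat k) * exp ((x + of_nat k) * z)" for z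
    by (auto intro!: DERIV_imp_deriv derivative_eq_intros)
  moreover have "(diff_op exp ^^ Suc k) (\<lambda>z. exp (x * z))
      = (\<lambda>z. exp z * deriv (\<lambda>z. pochhammer x k * exp ((x + of_nat k) * z)) z)"
    by (simp add: Suc) (simp add: diff_op_def)
  ultimately show ?case
    by (simp add: fun_eq_iff pochhammer_rec' exp_add algebra_simps)
qed simp

text \<open>At 0 every monomial in the derivatives of \<open>exp\<close> equals 1, so only the sums
  of the coefficients remain.\<close>

lemma pochhammer_expansion:
  assumes "1 \<le> k"
  shows "pochhammer x k = x ^ k
    + (\<Sum>s\<in>{1..<k}. (\<Sum>m=1..s. \<Sum>\<alpha>\<in>index_tuples m s. C s m k \<alpha>) * x ^ (k - s))"
proof -
  have "(exp :: complex \<Rightarrow> complex) meromorphic_on UNIV" "(\<lambda>z. exp (x * z)) meromorphic_on UNIV"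
    by (intro analytic_on_imp_meromorphic_on analytic_intros)+
  moreover have "(exp :: complex \<Rightarrow> complex) analytic_on {0}" "(\<lambda>z. exp (x * z)) analytic_on {0}"
    by (intro analytic_intros)+
  moreover have "(deriv ^^ i) exp 0 = (1::complex)" for i
    using higher_deriv_exp_mult[of i 1] by simp
  ultimately show ?thesis
    using C_properties(1)[OF assms] unfolding expansion_coeffs_def
    by (fastforce simp: diff_op_exp_power higher_deriv_exp_mult)
qed

section \<open>Comparison of coefficients of the rising factorial\<close>

theorem corollary3p5:
  fixes k s :: nat
  assumes "k \<ge> 1" and "s \<le> k"
  shows "(\<Sum>\<alpha>\<in>index_tuples s k. fact k / (\<Prod>i=1..k. of_nat i ^ \<alpha> i * fact (\<alpha> i)))
       = (if k - s = 0 then 1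
          else (\<Sum>m=1..k - s. \<Sum>\<alpha>\<in>index_tuples m (k - s). C (k - s) m k \<alpha>))"
proof -
  define T where "T = (\<lambda>s. \<Sum>m=1..s. \<Sum>\<alpha>\<in>index_tuples m s. C s m k \<alpha>)"
  \<comment> \<open>\<open>d j\<close> is the claimed coefficient of \<open>x ^ j\<close>; at
    \<open>j = k\<close> it is 1 by the convention for the leading term.\<close>
  define d where "d = (\<lambda>j. if j = k then 1 else T (k - j))"
  \<comment> \<open>The convention for \<open>s = k\<close> matches the vanishing constant term of
    the rising factorial.\<close>
  have Tk: "T k = 0"
    unfolding T_def by (intro sum.neutral ballI C_properties(2)[OF assms(1)]) simp
  have "(\<Sum>j\<le>k. of_nat (stirling k j) * x ^ j) = (\<Sum>j\<le>k. d j * x ^ j)" for x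
  proof -
    have "(\<Sum>j\<le>k. d j * x ^ j) = (\<Sum>s\<le>k. d (k - s) * x ^ (k - s))"
      by (rule sum.reindex_bij_witness[where i = "\<lambda>j. k - j" and j = "\<lambda>j. k - j"]) auto
    also have "\<dots> = x ^ k + (\<Sum>s\<in>{1..<k}. d (k - s) * x ^ (k - s))"
    proof -
      have "{..k} = insert 0 (insert k {1..<k})" using assms(1) by auto
      then show ?thesis using assms(1) Tk by (simp add: d_def)
    qed
    also have "(\<Sum>s\<in>{1..<k}. d (k - s) * x ^ (k - s)) = (\<Sum>s\<in>{1..<k}. T s * x ^ (k - s))"
      by (intro sum.cong) (auto simp: d_def)
    finally show ?thesis
      using pochhammer_expansion[OF assms(1), of x] by (simp add: T_def stirling_pochhammer)
  qed
  \<comment> \<open>Polynomial functions that agree at every complex \<open>x\<close> have equal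
    coefficients.\<close>
  then have "of_nat (stirling k s) = d s"
    using assms(2) polyfun_eq_coeffs[of "\<lambda>j. of_nat (stirling k j)" k d] by blast
  moreover have "(\<Sum>\<alpha>\<in>index_tuples s k. fact k / (\<Prod>i=1..k. of_nat i ^ \<alpha> i * fact (\<alpha> i)))
      = (fact k * cycle_sum k s :: complex)"
    by (simp add: cycle_sum_def cycle_weight_def sum_distrib_left)
  ultimately show ?thesis
    using assms(2) by (auto simp: cycle_sum_eq d_def T_def)
qed

end
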